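(* Let $K\ge 4$ be an integer and let $N$ be a positive integer such that $N/4$ is an integer. Consider a homogeneous $2\times 1$ broadcast network with $K$ users and coherence time $N$, in which $n_{\delta,1}=0$ and the offsets $n_{\delta,2},\dots,n_{\delta,K}$ are independent and uniformly distributed on $\{0,1,\dots,N-1\}$. Let $P(N,K,3)$ be the probability that the transmitter finds, among the $K$ users, three users that form a BIA-feasible $3$-user $2\times1$ broadcast channel, and let $f(N,K,3)$ be the number of tuples $(n_{\delta,2},\dots,n_{\delta,K})\in\{0,\dots,N-1\}^{K-1}$ for which no three of the $K$ users form a BIA-feasible $3$-user $2\times 1$ broadcast channel. Then $$P(N,K,3)=1-\frac{f(N,K,3)}{N^{K-1}}.$$
   Context: Network model. A homogeneous $2\times1$ broadcast network has one transmitter with two antennas $j\in\{1,2\}$ and $K$ single-antenna users. Time slots are $n=0,1,2,\dots$. Let $h_{ij}(n)\in\mathbb{C}$ be the coefficient from antenna $j$ to user $i$ at time $n$ and $H_i(n)=[h_{i1}(n),h_{i2}(n)]^T$. All users undergo independent block fading with the same coherence time $N$, and user $i$ has offset $n_{\delta,i}\in\{0,\dots,N-1\}$: slots $n,n'$ lie in the same coherence block of user $i$ iff $\lfloor (n-n_{\delta,i})/N\rfloor=\lfloor (n'-n_{\delta,i})/N\rfloor$, and $H_i(n)$ depends only on the coherence block of user $i$ containing $n$. The coefficients are otherwise generic: all $h_{ij}(n)$ are nonzero and, for each user, the vectors $H_i$ in two different coherence blocks are linearly independent. The transmitter knows $N$ and the offsets but not the coefficient values. Any three of the users, together with the transmitter,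 constitute a homogeneous $3$-user $2\times1$ broadcast channel (BC); below its users are relabelled $1,2,3$. BIA-feasible 4-symbol block. A 4-symbol channel block of a $3$-user BC is a choice of four time slots $n_1<n_2<n_3<n_4$ (not necessarily consecutive). Put $H_{ij}=\mathrm{diag}(h_{ij}(n_1),h_{ij}(n_2),h_{ij}(n_3),h_{ij}(n_4))$. The block is BIA-feasible (BIA = blind interference alignment) if there are vectors $\mathbf v_1,\mathbf v_2,\mathbf v_3,\mathbf u_1,\mathbf u_2,\mathbf u_3\in\mathbb{C}^{4}$, chosen without knowledge of the coefficient values, such that: (alignment) for all $i$ and all $k\ne i$ in $\{1,2,3\}$, $H_{i1}\mathbf v_k=c\,H_{i2}\mathbf u_k$ for some nonzero scalar $c$; and (decodability) for each $i$, the four vectors $H_{i1}\mathbf v_i$, $H_{i2}\mathbf u_i$ and $H_{i1}\mathbf v_k$ ($k\neq i$) are linearly independent. Six symbols are then delivered in four channel uses, giving $\tfrac32$ degrees of freedom. BIA-feasible BC. A homogeneous $3$-user $2\times 1$ BC is BIA-feasible if it can be fully decomposed into BIA-feasible 4-symbol channel blocks, i.e. its set of time slots, after discarding finitely many initial slots, can be partitioned into BIA-feasible 4-symbol channel blocks. *)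

theory Defs
  imports "HOL-Probability.Probability"
begin

text \<open>
  Index types: \<open>3\<close> for the users of a three-user broadcast channel, \<open>2\<close> for the antennas and
  \<open>4\<close> for the time slots of a block. In these types the numerals \<open>3\<close>, \<open>2\<close> and \<open>4\<close>
  (respectively) equal \<open>0\<close>; they serve only as labels, and the orders on these types are never used.
\<close>

text \<open>Linear independence over the scalar field of a finite family, so that repeated vectors
  are dependent.\<close>

definition lin_indep :: "('a::field ^ 'n) list \<Rightarrow> bool" where
  "lin_indep ws \<longleftrightarrow> distinct ws \<and> vec.independent (set ws)"

definition diag :: "('a::zero) ^ 'n \<Rightarrow> 'a ^ 'n ^ 'n" where
  "diag x = (\<chi> i j. if i = j then x $ i else 0)"

text \<open>Division on \<open>int\<close> rounds down, so this is the floor of \<open>(n - \<delta>) / N\<close>, also for \<open>n < \<delta>\<close>.\<close>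

definition coherence_block :: "nat \<Rightarrow> nat \<Rightarrow> nat \<Rightarrow> int" where
  "coherence_block N \<delta> n = (int n - int \<delta>) div int N"

text \<open>\<open>h i n $ j\<close> is the coefficient from antenna \<open>j\<close> to user \<open>i\<close> in slot \<open>n\<close>, and
  \<open>\<delta> i\<close> is the offset of user \<open>i\<close>.\<close>

definition admissible_channel :: "nat \<Rightarrow> (3 \<Rightarrow> nat) \<Rightarrow> (3 \<Rightarrow> nat \<Rightarrow> complex ^ 2) \<Rightarrow> bool" where
  "admissible_channel N \<delta> h \<longleftrightarrow>
     (\<forall>i n j. h i n $ j \<noteq> 0) \<and>
     (\<forall>i n n'. coherence_block N (\<delta> i) n = coherence_block N (\<delta> i) n' \<longrightarrow> h i n = h i n') \<and>
     (\<forall>i n n'. coherence_block N (\<delta> i) n \<noteq> coherence_block N (\<delta> i) n' \<longrightarrow>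
        lin_indep [h i n, h i n'])"

text \<open>The matrix \<open>H\<^sub>i\<^sub>j\<close> of a block with time slots \<open>t\<close>.\<close>

definition channel_matrix ::
    "(3 \<Rightarrow> nat \<Rightarrow> complex ^ 2) \<Rightarrow> (4 \<Rightarrow> nat) \<Rightarrow> 3 \<Rightarrow> 2 \<Rightarrow> complex ^ 4 ^ 4" where
  "channel_matrix h t i j = diag (\<chi> m. h i (t m) $ j)"

text \<open>The transmitter knows \<open>N\<close> and the offsets but not the coefficients: the vectors \<open>v\<close> and \<open>u\<close>
  are fixed before \<open>h\<close>, whereas the alignment scalar \<open>c\<close> may depend on \<open>h\<close>.\<close>

definition bia_feasible_block :: "nat \<Rightarrow> (3 \<Rightarrow> nat) \<Rightarrow> (4 \<Rightarrow> nat) \<Rightarrow> bool" where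
  "bia_feasible_block N \<delta> t \<longleftrightarrow>
     (\<exists>v u :: 3 \<Rightarrow> complex ^ 4. \<forall>h. admissible_channel N \<delta> h \<longrightarrow>
        (\<forall>i k. k \<noteq> i \<longrightarrow>
           (\<exists>c. c \<noteq> 0 \<and>
              channel_matrix h t i 1 *v v k = c *s (channel_matrix h t i 2 *v u k))) \<and>
        (\<forall>i k l. distinct [i, k, l] \<longrightarrow>
           lin_indep [channel_matrix h t i 1 *v v i, channel_matrix h t i 2 *v u i,
                      channel_matrix h t i 1 *v v k, channel_matrix h t i 1 *v v l]))"

definition bia_feasible_bc :: "nat \<Rightarrow> (3 \<Rightarrow> nat) \<Rightarrow> bool" where
  "bia_feasible_bc N \<delta> \<longleftrightarrow>
     (\<exists>n0 P. partition_on {n0..} P \<and>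
        (\<forall>B\<in>P. \<exists>t :: 4 \<Rightarrow> nat. t 1 < t 2 \<and> t 2 < t 3 \<and> t 3 < t 4 \<and>
           B = range t \<and> bia_feasible_block N \<delta> t))"

text \<open>Some three of the users \<open>1, \<dots>, K\<close>, relabelled by \<open>\<sigma>\<close>, form a feasible channel.\<close>

definition has_bia_feasible_triple :: "nat \<Rightarrow> nat \<Rightarrow> (nat \<Rightarrow> nat) \<Rightarrow> bool" where
  "has_bia_feasible_triple N K d \<longleftrightarrow>
     (\<exists>\<sigma> :: 3 \<Rightarrow> nat. inj \<sigma> \<and> range \<sigma> \<subseteq> {1..K} \<and> bia_feasible_bc N (d \<circ> \<sigma>))"

text \<open>The number of offset tuples of the users \<open>2, \<dots>, K\<close>, with user \<open>1\<close> at offset \<open>0\<close>,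
  that admit no feasible triple.\<close>

definition num_infeasible_offsets :: "nat \<Rightarrow> nat \<Rightarrow> nat" where
  "num_infeasible_offsets N K =
     card {d \<in> {2..K} \<rightarrow>\<^sub>E {..<N}. \<not> has_bia_feasible_triple N K (d(1 := 0))}"

end

theory Submission
  imports Defs
begin

text \<open>Independence and uniformity make the tuple of offsets of users \<open>2..K\<close>
  uniform on the \<open>N ^ (K - 1)\<close> points of
  \<open>{2..K} \<rightarrow>\<^sub>E {..<N}\<close>. Whether a feasible triple exists is a property
  of this tuple, user 1 having offset 0. The failure event is thus the preimage of the set counted
  by \<open>num_infeasible_offsets\<close>; its probability is that count over
  \<open>N ^ (K - 1)\<close>, and the claim follows by complement.
  \<open>prob_indep_uniform_family\<close> gives the uniform joint law;
  \<open>has_bia_feasible_triple_cong\<close> lets offsets change outside \<open>{1..K}\<close>, so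
  that a random family can be replaced by its restriction.\<close>

lemma has_bia_feasible_triple_cong:
  assumes "\<And>i. i \<in> {1..K} \<Longrightarrow> d i = d' i"
  shows "has_bia_feasible_triple N K d \<longleftrightarrow> has_bia_feasible_triple N K d'"
proof -
  have "d \<circ> \<sigma> = d' \<circ> \<sigma>" if "range \<sigma> \<subseteq> {1..K}" for \<sigma> :: "3 \<Rightarrow> nat"
    using assms range_subsetD[OF that] by (simp add: fun_eq_iff)
  then show ?thesis
    unfolding has_bia_feasible_triple_def by metis
qed

text \<open>The joint law is uniform: by independence each tuple has mass
  \<open>(1 / card S) ^ card I\<close>, and the finite set \<open>D\<close> collects one such mass
  per element.\<close>

lemma (in prob_space) prob_indep_uniform_family:
  assumes "finite I" "I \<noteq> {}" "finite S"
    and indep: "indep_vars (\<lambda>_. count_space S) X I"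
    and unif: "\<And>i. i \<in> I \<Longrightarrow> distr M (count_space S) (X i) = uniform_count_measure S"
    and D: "D \<subseteq> I \<rightarrow>\<^sub>E S"
  shows "{\<omega> \<in> space M. (\<lambda>i\<in>I. X i \<omega>) \<in> D} \<in> events"
    and "prob {\<omega> \<in> space M. (\<lambda>i\<in>I. X i \<omega>) \<in> D} = card D / real (card S) ^ card I"
proof -
  \<comment> \<open>\<open>E d\<close> is the fibre of the joint family over \<open>d\<close>. It
    lies inside \<open>space M\<close> because \<open>I\<close> is nonempty; an empty intersection
    would be the whole type.\<close>
  define E where "E d = (\<Inter>i\<in>I. X i -` {d i} \<inter> space M)" for d
  have meas: "X i \<in> measurable M (count_space S)" if "i \<in> I" for i
    using indep that by (auto simp: indep_vars_def)
  have "finite D"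
    using D assms(1,3) by (meson finite_PiE finite_subset)
  have preim: "X i -` {d i} \<inter> space M \<in> events" if "i \<in> I" "d \<in> D" for i d
    using that D by (intro measurable_sets[OF meas]) auto
  have E_events: "E d \<in> events" if "d \<in> D" for d
    unfolding E_def using assms(1,2) preim[OF _ that] by (intro sets.finite_INT) auto
  have coord: "prob (X i -` {d i} \<inter> space M) = 1 / card S" if "i \<in> I" "d \<in> D" for i d
  proof -
    have "d i \<in> S"
      using that D by auto
    then have "prob (X i -` {d i} \<inter> space M) = measure (distr M (count_space S) (X i)) {d i}"
      by (simp add: measure_distr meas that)
    also have "\<dots> = 1 / card S"
      using \<open>d i \<in> S\<close> assms(3) by (simp add: unif that measure_uniform_count_measure)
    finally show ?thesis .
  qed
  have prob_E: "prob (E d) = 1 / real (card S) ^ card I" if "d \<in> D" for d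
  proof -
    have "prob (E d) = (\<Prod>i\<in>I. prob (X i -` {d i} \<inter> space M))"
      unfolding E_def using assms(1,2) D that
      by (intro indep_varsD[OF indep]) (auto intro: PiE_mem)
    also have "\<dots> = (1 / card S) ^ card I"
      using coord[OF _ that] by simp
    finally show ?thesis
      by (simp add: power_one_over)
  qed
  have union: "{\<omega> \<in> space M. (\<lambda>i\<in>I. X i \<omega>) \<in> D} = (\<Union>d\<in>D. E d)"
  proof (intro equalityI subsetI)
    fix \<omega> assume "\<omega> \<in> (\<Union>d\<in>D. E d)"
    then obtain d where d: "d \<in> D" "\<omega> \<in> E d"
      by auto
    \<comment> \<open>Members of \<open>D\<close> are extensional, as is the restricted family, so
      agreement on \<open>I\<close> gives equality of functions.\<close>
    then have "(\<lambda>i\<in>I. X i \<omega>) = d"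
      using D \<open>I \<noteq> {}\<close> by (intro extensionalityI[of _ I]) (auto simp: E_def PiE_iff)
    then show "\<omega> \<in> {\<omega> \<in> space M. (\<lambda>i\<in>I. X i \<omega>) \<in> D}"
      using d \<open>I \<noteq> {}\<close> by (auto simp: E_def)
  next
    fix \<omega> assume \<omega>: "\<omega> \<in> {\<omega> \<in> space M. (\<lambda>i\<in>I. X i \<omega>) \<in> D}"
    then have "\<omega> \<in> E (\<lambda>i\<in>I. X i \<omega>)"
      by (simp add: E_def)
    with \<omega> show "\<omega> \<in> (\<Union>d\<in>D. E d)"
      by blast
  qed
  show "{\<omega> \<in> space M. (\<lambda>i\<in>I. X i \<omega>) \<in> D} \<in> events"
    unfolding union using \<open>finite D\<close> E_events by auto
  have "disjoint_family_on E D"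
    unfolding disjoint_family_on_def
  proof (intro ballI impI)
    fix d e assume "d \<in> D" "e \<in> D" "d \<noteq> e"
    then obtain i where "i \<in> I" "d i \<noteq> e i"
      using D PiE_ext[of d I "\<lambda>_. S" e] by blast
    then show "E d \<inter> E e = {}"
      by (auto simp: E_def)
  qed
  then have "prob (\<Union>d\<in>D. E d) = (\<Sum>d\<in>D. prob (E d))"
    using \<open>finite D\<close> E_events by (intro finite_measure_finite_Union) auto
  then show "prob {\<omega> \<in> space M. (\<lambda>i\<in>I. X i \<omega>) \<in> D} = card D / real (card S) ^ card I"
    unfolding union by (simp add: prob_E)
qed

theorem theorem4:
  fixes N K :: nat
    and M :: "'w measure"
    and n_delta :: "nat \<Rightarrow> 'w \<Rightarrow> nat"
  assumes "K \<ge> 4"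
    and "N > 0"
    and "4 dvd N"
    and "prob_space M"
    and "\<forall>\<omega>\<in>space M. n_delta 1 \<omega> = 0"
    and "prob_space.indep_vars M (\<lambda>_. count_space {..<N}) n_delta {2..K}"
    and "\<forall>i\<in>{2..K}. distr M (count_space {..<N}) (n_delta i) = uniform_count_measure {..<N}"
  shows "measure M {\<omega> \<in> space M. has_bia_feasible_triple N K (\<lambda>i. n_delta i \<omega>)} =
    1 - real (num_infeasible_offsets N K) / real N ^ (K - 1)"
proof -
  interpret prob_space M by fact
  define D where "D = {d \<in> {2..K} \<rightarrow>\<^sub>E {..<N}. \<not> has_bia_feasible_triple N K (d(1 := 0))}"
  define B where "B = {\<omega> \<in> space M. (\<lambda>i\<in>{2..K}. n_delta i \<omega>) \<in> D}"
  \<comment> \<open>The exponent is \<open>card {2..K} = K - 1\<close>, and \<open>K \<ge> 4\<close>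
    makes the index set nonempty.\<close>
  have B: "B \<in> events" "prob B = card D / real N ^ (K - 1)"
    using prob_indep_uniform_family[of "{2..K}" "{..<N}" n_delta D] assms
    by (auto simp: B_def D_def)
  \<comment> \<open>Measurability into \<open>count_space {..<N}\<close> bounds the offsets at every
    point of \<open>space M\<close>, not just almost surely.\<close>
  have in_range: "n_delta i \<omega> < N" if "i \<in> {2..K}" "\<omega> \<in> space M" for i \<omega>
  proof -
    have "n_delta i \<in> measurable M (count_space {..<N})"
      using assms(6) that by (auto simp: indep_vars_def)
    from measurable_space[OF this that(2)] show ?thesis
      by simp
  qed
  \<comment> \<open>Restriction makes the value at 1 \<open>undefined\<close>; the update restores
    the offset 0 that user 1 has by hypothesis.\<close>
  have restrict_eq: "has_bia_feasible_triple N K ((\<lambda>i\<in>{2..K}. n_delta i \<omega>)(1 := 0)) \<longleftrightarrow>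
      has_bia_feasible_triple N K (\<lambda>i. n_delta i \<omega>)" if "\<omega> \<in> space M" for \<omega>
    using assms(5) that by (intro has_bia_feasible_triple_cong) auto
  have "(\<lambda>i\<in>{2..K}. n_delta i \<omega>) \<in> D \<longleftrightarrow> \<not> has_bia_feasible_triple N K (\<lambda>i. n_delta i \<omega>)"
    if "\<omega> \<in> space M" for \<omega>
    unfolding D_def mem_Collect_eq restrict_eq[OF that] using in_range[OF _ that]
    by (simp add: restrict_PiE_iff)
  then have "{\<omega> \<in> space M. has_bia_feasible_triple N K (\<lambda>i. n_delta i \<omega>)} = space M - B"
    unfolding B_def by blast
  then show ?thesis
    using B by (simp add: prob_compl num_infeasible_offsets_def D_def)
qed

end
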